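(* Let $q,a,b$ be complex numbers with $0<|q|<1$ such that none of $a$, $b$, $ab$ belongs to $\{q^{-m}: m=0,1,2,\dots\}$. Then $$1+\sum_{n=1}^{\infty}(-1)^n q^{n(n-1)/2}(a^n+b^n)=(q,a,b;q)_{\infty}\sum_{n=0}^{\infty}\frac{(ab/q;q)_{2n}\,q^n}{(q,a,b,ab;q)_n}.$$
   Context: Notation: $(x;q)_n=\prod_{j=0}^{n-1}(1-xq^j)$ for $n\ge0$, $(x;q)_\infty=\prod_{j=0}^\infty(1-xq^j)$, and $(x_1,\dots,x_m;q)_n=(x_1;q)_n\cdots(x_m;q)_n$ (also for $n=\infty$). *)

theory Defs
  imports "HOL-Analysis.Analysis"
begin

definition qpoch :: "complex \<Rightarrow> complex \<Rightarrow> nat \<Rightarrow> complex" where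
  "qpoch x q n = (\<Prod>j<n. 1 - x * q ^ j)"

definition qpoch_inf :: "complex \<Rightarrow> complex \<Rightarrow> complex" where
  "qpoch_inf x q = (\<Prod>j. 1 - x * q ^ j)"

text \<open>The multi-parameter symbols: the list \<open>[x\<^sub>1, \<dots>, x\<^sub>m]\<close> stands for the parameters before
  the semicolon.\<close>

definition qpochs :: "complex list \<Rightarrow> complex \<Rightarrow> nat \<Rightarrow> complex" where
  "qpochs xs q n = (\<Prod>x\<leftarrow>xs. qpoch x q n)"

definition qpochs_inf :: "complex list \<Rightarrow> complex \<Rightarrow> complex" where
  "qpochs_inf xs q = (\<Prod>x\<leftarrow>xs. qpoch_inf x q)"

text \<open>For \<open>norm q < 1\<close> the infinite product converges, so \<^const>\<open>qpoch_inf\<close> is its value; this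
  includes the case where some factor vanishes and the value is \<open>0\<close>.\<close>

lemma has_prod_qpoch_inf:
  assumes "norm q < 1"
  shows "(\<lambda>j. 1 - x * q ^ j) has_prod qpoch_inf x q"
proof -
  have "summable (\<lambda>j. norm x * norm q ^ j)"
    using assms by (intro summable_mult summable_geometric) simp
  then have "abs_convergent_prod (\<lambda>j. 1 - x * q ^ j)"
    by (simp add: abs_convergent_prod_conv_summable norm_mult norm_power)
  then have "convergent_prod (\<lambda>j. 1 - x * q ^ j)"
    by (rule abs_convergent_prod_imp_convergent_prod)
  then show ?thesis
    unfolding qpoch_inf_def by (rule convergent_prod_has_prod)
qed

end

(*
  Write x = ab, c_n(x) = (x/q;q)_{2n} / (x;q)_n and
    S(a,b) = sum_n q^n / (q;q)_n (a q^n, b q^n; q)_inf c_n(ab),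
  so that the right-hand side is (q;q)_inf S(a,b).
  The mixed difference S(a,b) - S(aq,b) - S(a,bq) + S(aq,bq) vanishes: its terms telescope.
  Hence S(a,b) - S(aq,b) is invariant under b -> bq; letting b -> 0 and then treating a in the
  same way gives S(a,b) = S(a,0) + S(0,b) - S(0,0).
  Finally g(a) = (q;q)_inf S(a,0) satisfies g(a) = 1 - a g(aq), again by telescoping, and
  iterating this recurrence produces the partial theta series.
*)

theory Submission
  imports Defs
begin

section \<open>Finite q-Pochhammer symbols and the summands of S(a,b)\<close>

lemma qpoch_0 [simp]: "qpoch x q 0 = 1"
  by (simp add: qpoch_def)

lemma qpoch_Suc: "qpoch x q (Suc n) = qpoch x q n * (1 - x * q ^ n)"
  by (simp add: qpoch_def)

lemma qpoch_Suc_shift: "qpoch x q (Suc n) = (1 - x) * qpoch (x * q) q n"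
  unfolding qpoch_def prod.lessThan_Suc_shift by (simp add: mult.assoc)

lemma qpoch_0_left [simp]: "qpoch 0 q n = 1"
  by (simp add: qpoch_def)

lemma qpoch_add: "qpoch x q (m + n) = qpoch x q m * qpoch (x * q ^ m) q n"
  by (induction n) (simp_all add: qpoch_Suc power_add mult.assoc)

lemma qpoch_inf_0_left [simp]: "qpoch_inf 0 q = 1"
  by (simp add: qpoch_inf_def)

text \<open>The quotient \<open>(x/q;q)\<^sub>2\<^sub>n / (x;q)\<^sub>n\<close> with the common factors cancelled, so
  that it is a polynomial in \<open>x\<close> and needs no nonvanishing condition.\<close>

definition cfac :: "complex \<Rightarrow> complex \<Rightarrow> nat \<Rightarrow> complex" where
  "cfac q x n = (if n = 0 then 1 else (1 - x / q) * qpoch (x * q ^ n) q (n - 1))"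

lemma cfac_0 [simp]: "cfac q x 0 = 1"
  by (simp add: cfac_def)

lemma cfac_Suc: "cfac q x (Suc n) = (1 - x / q) * qpoch (x * q ^ Suc n) q n"
  by (simp add: cfac_def)

lemma cfac_0_arg [simp]: "cfac q 0 n = 1"
  by (simp add: cfac_def)

text \<open>Cut the 2n factors of (x/q;q)_{2n} into the first one, the n factors of (x;q)_n, and the
  remaining n-1. This links \<open>cfac\<close> to the quotient in the theorem.\<close>

lemma cfac_mult_qpoch:
  assumes "q \<noteq> 0"
  shows "cfac q x n * qpoch x q n = qpoch (x / q) q (2 * n)"
proof (cases n)
  case (Suc m)
  have "qpoch (x / q) q (2 * n) = (1 - x / q) * qpoch x q (n + m)"
    using assms qpoch_Suc_shift[of "x / q" q "n + m"] by (simp add: Suc mult_2)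
  then show ?thesis
    unfolding qpoch_add by (simp add: Suc cfac_Suc mult_ac)
qed simp

text \<open>Multiplying by (a,b;q)_inf turns 1/(a;q)_n into (a q^n;q)_inf and likewise for b, so the
  terms make sense for all a and b, including 0. The argument x stands for ab but is kept
  independent, because the telescoping pairs unshifted a, b with a shifted x.\<close>

definition wterm :: "complex \<Rightarrow> complex \<Rightarrow> complex \<Rightarrow> complex \<Rightarrow> nat \<Rightarrow> complex" where
  "wterm q a b x n =
     q ^ n / qpoch q q n * qpoch_inf (a * q ^ n) q * qpoch_inf (b * q ^ n) q * cfac q x n"

definition wsum :: "complex \<Rightarrow> complex \<Rightarrow> complex \<Rightarrow> complex" where
  "wsum q a b = (\<Sum>n. wterm q a b (a * b) n)"

lemma wsum_commute: "wsum q a b = wsum q b a"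
  by (simp add: wsum_def wterm_def mult_ac)

section \<open>Infinite products for 0 < |q| < 1\<close>

context
  fixes q :: complex
  assumes q0: "0 < norm q" and q1: "norm q < 1"
begin

lemma q_nonzero [simp]: "q \<noteq> 0"
  using q0 by auto

lemma q_power_neq_1: "q ^ Suc n \<noteq> 1"
proof
  assume "q ^ Suc n = 1"
  then have "norm q ^ Suc n = 1"
    by (metis norm_one norm_power)
  moreover have "norm q ^ Suc n < 1"
    using q1 by (intro power_Suc_less_one) auto
  ultimately show False by simp
qed

lemma qpoch_q_nonzero [simp]: "qpoch q q n \<noteq> 0"
  using q_power_neq_1 by (auto simp: qpoch_def)

lemma qpoch_tendsto: "qpoch x q \<longlonglongrightarrow> qpoch_inf x q"
  using has_prod_imp_tendsto'[OF has_prod_qpoch_inf[OF q1]] by (simp add: qpoch_def[abs_def])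

lemma qpoch_inf_q_nonzero [simp]: "qpoch_inf q q \<noteq> 0"
  using has_prod_eq_0_iff[OF has_prod_qpoch_inf[OF q1, of q]] q_power_neq_1 by auto

text \<open>Pass to the limit in \<open>qpoch_add\<close>; no division occurs, so vanishing factors
  are harmless.\<close>

lemma qpoch_inf_split: "qpoch_inf x q = qpoch x q n * qpoch_inf (x * q ^ n) q"
proof (rule LIMSEQ_unique)
  show "(\<lambda>m. qpoch x q (n + m)) \<longlonglongrightarrow> qpoch_inf x q"
    using LIMSEQ_ignore_initial_segment[OF qpoch_tendsto, of x n] by (simp add: add.commute)
  show "(\<lambda>m. qpoch x q (n + m)) \<longlonglongrightarrow> qpoch x q n * qpoch_inf (x * q ^ n) q"
    unfolding qpoch_add by (intro tendsto_intros qpoch_tendsto)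
qed

lemma qpoch_inf_Suc: "qpoch_inf x q = (1 - x) * qpoch_inf (x * q) q"
  using qpoch_inf_split[of x 1] by (simp add: qpoch_Suc)

section \<open>Uniform bounds and limits as a parameter tends to 0\<close>

text \<open>Majorant of all products of the factors 1 + r |q|^j: use 1 + u \<le> exp u and sum the
  geometric series.\<close>

definition ebound :: "real \<Rightarrow> real" where
  "ebound r = exp (r / (1 - norm q))"

lemma ebound_mono: "r \<le> s \<Longrightarrow> ebound r \<le> ebound s"
  using q1 by (simp add: ebound_def divide_right_mono)

lemma ebound_pos [simp]: "0 < ebound r"
  by (simp add: ebound_def)

lemma prod_le_ebound:
  fixes x :: complex
  shows "(\<Prod>j<n. 1 + norm x * norm q ^ j) \<le> ebound (norm x)"
proof -
  have "(\<Prod>j<n. 1 + norm x * norm q ^ j) \<le> exp (\<Sum>j<n. norm x * norm q ^ j)"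
    by (rule prod_le_exp_sum) auto
  also have "(\<Sum>j<n. norm q ^ j) \<le> 1 / (1 - norm q)"
    using sum_le_suminf[OF summable_geometric[of "norm q"], of "{..<n}"] q1
    by (simp add: suminf_geometric)
  then have "exp (\<Sum>j<n. norm x * norm q ^ j) \<le> ebound (norm x)"
    using mult_left_mono[of _ _ "norm x"] by (fastforce simp: ebound_def sum_distrib_left)
  finally show ?thesis .
qed

lemma norm_qpoch_le: "norm (qpoch x q n) \<le> ebound (norm x)"
proof -
  have "norm (qpoch x q n) \<le> (\<Prod>j<n. 1 + norm x * norm q ^ j)"
    unfolding qpoch_def prod_norm[symmetric]
    by (intro prod_mono) (auto intro!: order_trans[OF norm_triangle_ineq4] simp: norm_mult norm_power)
  with prod_le_ebound show ?thesis
    using order_trans by blast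
qed

text \<open>Since \<open>ebound 0\<close> is 1, this estimate forces (x;q)_inf to tend to 1 as x
  tends to 0.\<close>

lemma norm_qpoch_minus_1_le: "norm (qpoch x q n - 1) \<le> ebound (norm x) - 1"
proof -
  have "norm (qpoch x q n - 1) \<le> (\<Prod>j<n. 1 + norm x * norm q ^ j) - 1"
    using norm_prod_minus1_le_prod_minus1[of "\<lambda>j. - (x * q ^ j)" "{..<n}"]
    by (simp add: qpoch_def norm_mult norm_power)
  with prod_le_ebound[of x n] show ?thesis by linarith
qed

lemma norm_qpoch_inf_le: "norm (qpoch_inf x q) \<le> ebound (norm x)"
  by (rule tendsto_upperbound[OF tendsto_norm[OF qpoch_tendsto]]) (auto simp: norm_qpoch_le)

lemma norm_qpoch_inf_minus_1_le: "norm (qpoch_inf x q - 1) \<le> ebound (norm x) - 1"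
  by (rule tendsto_upperbound[OF tendsto_norm[OF tendsto_diff[OF qpoch_tendsto tendsto_const]]])
    (auto simp: norm_qpoch_minus_1_le)

lemma power_q_tendsto_0: "(\<lambda>k. q ^ k) \<longlonglongrightarrow> 0"
  using q1 by (rule LIMSEQ_power_zero)

lemma qpoch_inf_tendsto_1:
  assumes "f \<longlonglongrightarrow> 0"
  shows "(\<lambda>k. qpoch_inf (f k) q) \<longlonglongrightarrow> 1"
proof -
  have "(\<lambda>k. exp (norm (f k) / (1 - norm q)) - 1) \<longlonglongrightarrow> exp (norm (0::complex) / (1 - norm q)) - 1"
    using q1 assms by (intro tendsto_intros) auto
  then have "(\<lambda>k. ebound (norm (f k)) - 1) \<longlonglongrightarrow> 0"
    by (simp add: ebound_def)
  then have "(\<lambda>k. qpoch_inf (f k) q - 1) \<longlonglongrightarrow> 0"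
    by (rule Lim_null_comparison[rotated]) (simp add: norm_qpoch_inf_minus_1_le)
  then show ?thesis
    by (simp add: LIM_zero_iff)
qed

text \<open>The reciprocals converge because (q;q)_inf is nonzero, and convergent sequences are
  bounded.\<close>

lemma inverse_qpoch_q_bounded:
  obtains K where "0 < K" "\<And>n. norm (1 / qpoch q q n) \<le> K"
proof -
  have "(\<lambda>n. 1 / qpoch q q n) \<longlonglongrightarrow> 1 / qpoch_inf q q"
    by (intro tendsto_intros qpoch_tendsto) simp
  then have "Bseq (\<lambda>n. 1 / qpoch q q n)"
    by (intro convergent_imp_Bseq convergentI)
  then show ?thesis
    using that by (auto elim!: BseqE)
qed

lemma norm_mult_power_q_le: "norm (a * q ^ n) \<le> norm a"
  using q1 by (simp add: norm_mult norm_power mult_left_le power_le_one)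

lemma norm_cfac_le: "norm (cfac q x n) \<le> (1 + norm x / norm q) * ebound (norm x)"
proof (cases n)
  case 0
  have "1 \<le> ebound (norm x)"
    using q1 by (simp add: ebound_def)
  then have "1 * 1 \<le> (1 + norm x / norm q) * ebound (norm x)"
    by (intro mult_mono) auto
  then show ?thesis by (simp add: 0)
next
  case (Suc m)
  have "norm (1 - x / q) \<le> 1 + norm x / norm q"
    by (metis norm_divide norm_one norm_triangle_ineq4)
  moreover have "norm (qpoch (x * q ^ n) q m) \<le> ebound (norm x)"
    using norm_qpoch_le ebound_mono[OF norm_mult_power_q_le] order_trans by blast
  ultimately show ?thesis
    unfolding Suc cfac_Suc norm_mult by (intro mult_mono) (auto simp: Suc)
qed

text \<open>A single \<open>M\<close> serves whole discs of parameters, so the geometric majorant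
  yields both summability and the domination needed to exchange limit and sum.\<close>

lemma wterm_bound:
  obtains M where "\<And>a b x n. norm a \<le> r \<Longrightarrow> norm b \<le> s \<Longrightarrow> norm x \<le> t \<Longrightarrow>
    norm (wterm q a b x n) \<le> M * norm q ^ n"
proof -
  obtain K where K: "0 < K" "\<And>n. norm (1 / qpoch q q n) \<le> K"
    by (rule inverse_qpoch_q_bounded) blast
  show ?thesis
  proof (rule that)
    fix a b x :: complex and n assume le: "norm a \<le> r" "norm b \<le> s" "norm x \<le> t"
    have inf: "norm (qpoch_inf (y * q ^ n) q) \<le> ebound u" if "norm y \<le> u" for y u
      by (intro order_trans[OF norm_qpoch_inf_le] ebound_mono order_trans[OF norm_mult_power_q_le] that)
    have t: "0 \<le> t"
      using le(3) norm_ge_zero order_trans by blast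
    have "norm (cfac q x n) \<le> (1 + t / norm q) * ebound t"
      using le t
      by (intro order_trans[OF norm_cfac_le] mult_mono ebound_mono add_mono divide_right_mono)
        (auto intro: less_imp_le)
    with t have "norm q ^ n * (norm (1 / qpoch q q n) * norm (qpoch_inf (a * q ^ n) q) *
        norm (qpoch_inf (b * q ^ n) q) * norm (cfac q x n)) \<le>
        norm q ^ n * (K * ebound r * ebound s * ((1 + t / norm q) * ebound t))"
      using le K by (intro mult_left_mono mult_mono inf) (auto intro!: mult_nonneg_nonneg less_imp_le)
    then show "norm (wterm q a b x n) \<le>
        (K * ebound r * ebound s * ((1 + t / norm q) * ebound t)) * norm q ^ n"
      by (simp add: wterm_def norm_mult norm_divide norm_power mult_ac)
  qed
qed

lemma summable_wterm: "summable (wterm q a b x)"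
proof -
  obtain M where M: "\<And>a' b' x' n. norm a' \<le> norm a \<Longrightarrow> norm b' \<le> norm b \<Longrightarrow> norm x' \<le> norm x \<Longrightarrow>
    norm (wterm q a' b' x' n) \<le> M * norm q ^ n"
    by (rule wterm_bound[of "norm a" "norm b" "norm x"]) blast
  show ?thesis
  proof (rule summable_comparison_test')
    show "summable (\<lambda>n. M * norm q ^ n)"
      using q1 by (intro summable_mult summable_geometric) simp
    show "norm (wterm q a b x n) \<le> M * norm q ^ n" if "n \<ge> 0" for n
      using M by simp
  qed
qed

lemma cfac_tendsto_1:
  assumes "f \<longlonglongrightarrow> 0"
  shows "(\<lambda>k. cfac q (f k) n) \<longlonglongrightarrow> 1"
proof (cases n)
  case (Suc m)
  have "(\<lambda>k. cfac q (f k) n) \<longlonglongrightarrow> (1 - 0 / q) * (\<Prod>j<m. 1 - 0 * q ^ n * q ^ j)"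
    unfolding Suc cfac_Suc qpoch_def by (intro tendsto_intros assms) auto
  then show ?thesis by simp
qed simp

text \<open>Tannery's theorem: each term converges, and the common majorant applies because
  multiplying by q^k does not increase the norm.\<close>

lemma wsum_tendsto: "(\<lambda>k. wsum q (a * q ^ k) b) \<longlonglongrightarrow> wsum q 0 b"
proof -
  obtain M where M: "\<And>a' b' x' n. norm a' \<le> norm a \<Longrightarrow> norm b' \<le> norm b \<Longrightarrow>
    norm x' \<le> norm (a * b) \<Longrightarrow> norm (wterm q a' b' x' n) \<le> M * norm q ^ n"
    by (rule wterm_bound[of "norm a" "norm b" "norm (a * b)"]) blast
  have lim: "(\<lambda>k. wterm q (a * q ^ k) b (a * q ^ k * b) n) \<longlonglongrightarrow> wterm q 0 b (0 * b) n" for n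
  proof -
    have "(\<lambda>k. a * q ^ k * q ^ n) \<longlonglongrightarrow> a * 0 * q ^ n" "(\<lambda>k. a * q ^ k * b) \<longlonglongrightarrow> a * 0 * b"
      by (intro tendsto_intros power_q_tendsto_0)+
    then have "(\<lambda>k. qpoch_inf (a * q ^ k * q ^ n) q) \<longlonglongrightarrow> 1"
      "(\<lambda>k. cfac q (a * q ^ k * b) n) \<longlonglongrightarrow> 1"
      by (auto intro!: qpoch_inf_tendsto_1 cfac_tendsto_1)
    then have "(\<lambda>k. wterm q (a * q ^ k) b (a * q ^ k * b) n) \<longlonglongrightarrow>
      q ^ n / qpoch q q n * 1 * qpoch_inf (b * q ^ n) q * 1"
      unfolding wterm_def by (intro tendsto_mult tendsto_const) auto
    then show ?thesis by (simp add: wterm_def)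
  qed
  have bnd: "norm (wterm q (a * q ^ k) b (a * q ^ k * b) n) \<le> M * norm q ^ n" for k n
    using norm_mult_power_q_le[of a k] norm_mult_power_q_le[of "a * b" k]
    by (intro M) (auto simp: mult_ac)
  show ?thesis
    unfolding wsum_def
    by (rule tannerys_theorem[THEN conjunct2, THEN conjunct2, OF lim])
      (use bnd q1 in \<open>auto intro!: always_eventually summable_mult summable_geometric\<close>)
qed

section \<open>Telescoping of the mixed difference and separation of a from b\<close>

text \<open>The relation that makes the mixed difference telescope: it trades index n+1 for index n
  at the cost of shifting x. It reduces to a polynomial identity once a common product is
  extracted.\<close>

lemma cfac_contiguous:
  "q ^ Suc n / qpoch q q (Suc n) * (cfac q (x * q) (Suc n) - cfac q x (Suc n)) =
   q ^ n / qpoch q q n * (cfac q (x * q\<^sup>2) n - (1 - x * q ^ (2 * n)) * cfac q (x * q) n)"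
proof -
  have "q * (cfac q (x * q) (Suc n) - cfac q x (Suc n)) =
    (1 - q ^ Suc n) * (cfac q (x * q\<^sup>2) n - (1 - x * q ^ (2 * n)) * cfac q (x * q) n)"
  proof (cases n)
    case 0
    then show ?thesis by (simp add: cfac_Suc field_simps)
  next
    case (Suc m)
    \<comment> \<open>With n = m+1, this product divides all four terms; \<open>c1\<close> to
      \<open>c4\<close> record the cofactors. The case n = 0 is separate because \<open>cfac\<close>
      has its own value there.\<close>
    define P where "P = qpoch (x * q ^ (n + 2)) q m"
    define Q where "Q = q ^ n"
    have c1: "cfac q (x * q) (Suc n) = (1 - x) * (P * (1 - x * q * Q\<^sup>2))"
      using qpoch_Suc[of "x * q ^ (n + 2)" q m]
      by (simp add: cfac_Suc P_def Q_def Suc mult_ac power_add power2_eq_square)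
    have c2: "cfac q x (Suc n) = (1 - x / q) * ((1 - x * q * Q) * P)"
      using qpoch_Suc_shift[of "x * q ^ (n + 1)" q m]
      by (simp add: cfac_Suc P_def Q_def Suc mult_ac)
    have c3: "cfac q (x * q\<^sup>2) n = (1 - x * q) * P"
      by (simp add: cfac_Suc P_def Suc mult_ac power_add power2_eq_square)
    \<comment> \<open>As n+1+m = 2n, the extra factor is exactly the next one of the
      product.\<close>
    have "(1 - x * q ^ (2 * n)) * qpoch (x * q ^ (n + 1)) q m = qpoch (x * q ^ (n + 1)) q (Suc m)"
      by (simp add: qpoch_Suc Suc mult_ac power_add)
        (metis mult_2_right power_add)
    then have c4: "(1 - x * q ^ (2 * n)) * cfac q (x * q) n = (1 - x) * ((1 - x * q * Q) * P)"
      using qpoch_Suc_shift[of "x * q ^ (n + 1)" q m]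
      by (simp add: cfac_Suc P_def Q_def Suc mult_ac)
    show ?thesis
      unfolding c4 unfolding c1 c2 c3 power_Suc Q_def[symmetric]
      by (simp add: field_simps) algebra
  qed
  moreover have "q ^ Suc n / qpoch q q (Suc n) * X = q ^ n / qpoch q q n * Y"
    if "q * X = (1 - q ^ Suc n) * Y" for X Y
  proof -
    have "q ^ Suc n / qpoch q q (Suc n) * X = q ^ n / qpoch q q n * (q * X / (1 - q ^ Suc n))"
      by (simp add: qpoch_Suc)
    also have "q * X / (1 - q ^ Suc n) = Y"
      using that q_power_neq_1[of n] by simp
    finally show ?thesis .
  qed
  ultimately show ?thesis
    by blast
qed

text \<open>Write Q = q^n. After extracting (a q^{n+1}, b q^{n+1};q)_inf and adding V n, the
  coefficient of c_n(xq) is (1-aQ)(1-bQ) - (1-aQ) - (1-bQ) = x Q^2 - 1. It depends on x alone, so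
  \<open>cfac_contiguous\<close> identifies the result as V (n+1).\<close>

lemma wterm_mixed_difference:
  fixes a b :: complex
  defines "x \<equiv> a * b"
  defines "V \<equiv> \<lambda>n. wterm q a b (x * q) n - wterm q a b x n"
  shows "wterm q a b x n - wterm q (a * q) b (x * q) n - wterm q a (b * q) (x * q) n
    + wterm q (a * q) (b * q) (x * q\<^sup>2) n = V (Suc n) - V n"
proof -
  define A where "A = qpoch_inf (a * q ^ Suc n) q"
  define B where "B = qpoch_inf (b * q ^ Suc n) q"
  define w where "w = q ^ n / qpoch q q n"
  have A: "qpoch_inf (a * q ^ n) q = (1 - a * q ^ n) * A"
    using qpoch_inf_Suc[of "a * q ^ n"] by (simp add: A_def mult_ac)
  have B: "qpoch_inf (b * q ^ n) q = (1 - b * q ^ n) * B"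
    using qpoch_inf_Suc[of "b * q ^ n"] by (simp add: B_def mult_ac)
  have A': "qpoch_inf (a * q * q ^ n) q = A" and B': "qpoch_inf (b * q * q ^ n) q = B"
    by (simp_all add: A_def B_def mult_ac)
  have "V (Suc n) = A * B * (q ^ Suc n / qpoch q q (Suc n) * (cfac q (x * q) (Suc n) - cfac q x (Suc n)))"
    unfolding V_def wterm_def A_def[symmetric] B_def[symmetric] by (simp add: algebra_simps)
  also have "\<dots> = A * B * (w * (cfac q (x * q\<^sup>2) n - (1 - x * q ^ (2 * n)) * cfac q (x * q) n))"
    unfolding cfac_contiguous w_def ..
  finally have V: "V (Suc n) = \<dots>" .
  have sq: "q ^ (2 * n) = q ^ n * q ^ n"
    by (simp add: mult_2 power_add)
  show ?thesis
    unfolding V unfolding V_def wterm_def A B A' B' w_def[symmetric] sq x_def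
    by (simp add: algebra_simps)
qed

lemma wsum_mixed_difference:
  "wsum q a b - wsum q (a * q) b = wsum q a (b * q) - wsum q (a * q) (b * q)"
proof -
  define x where "x = a * b"
  define V where "V n = wterm q a b (x * q) n - wterm q a b x n" for n
  have "(\<lambda>n. wterm q a b x n - wterm q (a * q) b (x * q) n - wterm q a (b * q) (x * q) n
      + wterm q (a * q) (b * q) (x * q\<^sup>2) n) sums
      (wsum q a b - wsum q (a * q) b - wsum q a (b * q) + wsum q (a * q) (b * q))"
    using summable_sums[OF summable_wterm] unfolding wsum_def x_def
    by (intro sums_add sums_diff) (simp_all add: mult_ac power2_eq_square)
  moreover have "V \<longlonglongrightarrow> 0 - 0"
    unfolding V_def by (intro tendsto_diff summable_LIMSEQ_zero summable_wterm)
  then have "(\<lambda>n. V (Suc n) - V n) sums (0 - 0 - V 0)"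
    by (rule telescope_sums)
  \<comment> \<open>The boundary term \<open>V 0\<close> is 0, because \<open>cfac\<close> at index
    0 is 1 for every x.\<close>
  then have "(\<lambda>n. V (Suc n) - V n) sums 0"
    by (simp add: V_def wterm_def)
  ultimately have "wsum q a b - wsum q (a * q) b - wsum q a (b * q) + wsum q (a * q) (b * q) = 0"
    using wterm_mixed_difference[of a b] sums_unique2 unfolding V_def x_def by fastforce
  then show ?thesis by (simp add: algebra_simps)
qed

text \<open>Invariance makes F constant along the orbit a q^k, so its value is the limit at the end
  of the orbit.\<close>

lemma tendsto_power_q_eq:
  fixes F :: "complex \<Rightarrow> complex"
  assumes "\<And>a. F (a * q) = F a" "(\<lambda>k. F (a * q ^ k)) \<longlonglongrightarrow> L"
  shows "F a = L"
proof -
  have "F (a * q ^ k) = F a" for k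
    by (induction k) (use assms(1)[of "a * q ^ _"] in \<open>auto simp: mult_ac\<close>)
  with assms(2) show ?thesis
    by (simp add: LIMSEQ_const_iff)
qed

lemma wsum_separate: "wsum q a b = wsum q a 0 + wsum q b 0 - wsum q 0 0"
proof -
  have lim: "(\<lambda>k. wsum q y (z * q ^ k)) \<longlonglongrightarrow> wsum q y 0" for y z
    using wsum_tendsto[of z y] by (simp add: wsum_commute[of q y])
  have "wsum q a b - wsum q (a * q) b = wsum q a 0 - wsum q (a * q) 0" for a b
    by (rule tendsto_power_q_eq[where F = "\<lambda>b. wsum q a b - wsum q (a * q) b"])
      (rule wsum_mixed_difference[symmetric], intro tendsto_diff lim)
  \<comment> \<open>Regrouping exhibits a function of a invariant under a -> aq, ready for the
    second limit.\<close>
  then have "wsum q (a * q) b - wsum q (a * q) 0 = wsum q a b - wsum q a 0" for a b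
    by (simp add: algebra_simps)
  then have "wsum q a b - wsum q a 0 = wsum q 0 b - wsum q 0 0"
    by (rule tendsto_power_q_eq[where F = "\<lambda>a. wsum q a b - wsum q a 0"])
      (intro tendsto_diff wsum_tendsto)
  then show ?thesis
    by (simp add: wsum_commute[of q 0 b] algebra_simps)
qed

section \<open>The one-variable function and its partial theta expansion\<close>

lemma wsum_0_right_rec: "qpoch_inf q q * wsum q a 0 = 1 - a * (qpoch_inf q q * wsum q (a * q) 0)"
proof -
  \<comment> \<open>An antidifference of the combined terms: the factor 1 - q^n gives
    \<open>U 0 = 0\<close> and cancels the last factor of (q;q)_{n+1} in \<open>U (Suc n)\<close>.
    Its limit is 1/(q;q)_inf.\<close>
  define U where "U n = qpoch_inf (a * q ^ n) q * (1 - q ^ n) / qpoch q q n" for n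
  have "wterm q a 0 0 n + a * wterm q (a * q) 0 0 n = U (Suc n) - U n" for n
  proof -
    define A where "A = qpoch_inf (a * q ^ Suc n) q"
    have A: "qpoch_inf (a * q ^ n) q = (1 - a * q ^ n) * A" and A': "qpoch_inf (a * q * q ^ n) q = A"
      using qpoch_inf_Suc[of "a * q ^ n"] by (simp_all add: A_def mult_ac)
    have U: "U (Suc n) = A / qpoch q q n"
      using q_power_neq_1[of n] by (simp add: U_def A_def qpoch_Suc)
    show ?thesis
      unfolding U unfolding U_def wterm_def A A' by (simp add: field_simps)
  qed
  moreover have "(\<lambda>n. wterm q a 0 0 n + a * wterm q (a * q) 0 0 n) sums
      (wsum q a 0 + a * wsum q (a * q) 0)"
    using summable_sums[OF summable_wterm] unfolding wsum_def
    by (intro sums_add sums_mult) simp_all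
  moreover have "(\<lambda>n. U (Suc n) - U n) sums (1 * (1 - 0) / qpoch_inf q q - U 0)"
  proof -
    have "(\<lambda>n. a * q ^ n) \<longlonglongrightarrow> a * 0"
      by (intro tendsto_intros power_q_tendsto_0)
    then show ?thesis
      unfolding U_def
      by (intro telescope_sums tendsto_intros qpoch_inf_tendsto_1 power_q_tendsto_0 qpoch_tendsto) auto
  qed
  ultimately have "wsum q a 0 + a * wsum q (a * q) 0 = 1 / qpoch_inf q q"
    using sums_unique2 by (fastforce simp: U_def)
  then show ?thesis
    by (simp add: field_simps)
qed

lemma qpoch_inf_wsum_0_0: "qpoch_inf q q * wsum q 0 0 = 1"
  using wsum_0_right_rec[of 0] by simp

lemma partial_theta_sums:
  "(\<lambda>n. (-1) ^ n * q ^ ((n * (n - 1)) div 2) * a ^ n) sums (qpoch_inf q q * wsum q a 0)"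
proof -
  define g where "g a = qpoch_inf q q * wsum q a 0" for a
  define t where "t n = (-1) ^ n * q ^ ((n * (n - 1)) div 2) * a ^ n" for n
  have t_Suc: "t (Suc n) = - a * q ^ n * t n" for n
  proof -
    have "(Suc n * (Suc n - 1)) div 2 = n * (n - 1) div 2 + n"
      by (induction n) auto
    then show ?thesis by (simp add: t_def power_add)
  qed
  \<comment> \<open>The recurrence g(a) = 1 - a g(aq), iterated k times.\<close>
  have "g a = (\<Sum>n<k. t n) + t k * g (a * q ^ k)" for k
  proof (induction k)
    case (Suc k)
    have "g (a * q ^ k) = 1 - a * q ^ k * g (a * q ^ Suc k)"
      using wsum_0_right_rec[of "a * q ^ k"] by (simp add: g_def mult_ac)
    with Suc show ?case
      by (simp add: t_Suc algebra_simps)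
  qed (simp add: t_def)
  then have part: "(\<Sum>n<k. t n) = g a - t k * g (a * q ^ k)" for k
    by (metis add_diff_cancel_right')
  have g_lim: "(\<lambda>k. g (a * q ^ k)) \<longlonglongrightarrow> 1"
    using tendsto_mult[OF tendsto_const[of "qpoch_inf q q"] wsum_tendsto[of a 0]]
    by (simp add: g_def qpoch_inf_wsum_0_0)
  \<comment> \<open>Consecutive terms have ratio -a q^n, which tends to 0.\<close>
  have "summable t"
  proof -
    have "(\<lambda>n. norm (a * q ^ n)) \<longlonglongrightarrow> norm (a * 0)"
      by (intro tendsto_intros power_q_tendsto_0)
    then have "eventually (\<lambda>n. norm (a * q ^ n) < 1 / 2) sequentially"
      by (intro order_tendstoD) auto
    then obtain N where N: "\<And>n. n \<ge> N \<Longrightarrow> norm (a * q ^ n) < 1 / 2"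
      by (auto simp: eventually_sequentially)
    show ?thesis
    proof (rule summable_ratio_test)
      show "norm (t (Suc n)) \<le> 1 / 2 * norm (t n)" if "n \<ge> N" for n
        using N[OF that] unfolding t_Suc norm_mult[of _ "t n"] by (intro mult_right_mono) auto
    qed simp
  qed
  \<comment> \<open>The remainder vanishes: t k tends to 0 by summability, while g(a q^k) tends to
    g(0) = 1.\<close>
  then have "(\<lambda>k. g a - t k * g (a * q ^ k)) \<longlonglongrightarrow> g a - 0 * 1"
    by (intro tendsto_intros g_lim summable_LIMSEQ_zero)
  then have "t sums g a"
    by (simp add: sums_def part)
  then show ?thesis
    unfolding t_def[abs_def] g_def .
qed

section \<open>Nonvanishing denominators and assembly of the identity\<close>

lemma qpoch_nonzero:
  assumes "x \<notin> range (\<lambda>m::nat. 1 / q ^ m)"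
  shows "qpoch x q n \<noteq> 0"
  using assms by (auto simp: qpoch_def divide_simps)

end

theorem theorem1p5:
  fixes q a b :: complex
  assumes "0 < norm q" and "norm q < 1"
    and "a \<notin> range (\<lambda>m::nat. 1 / q ^ m)"
    and "b \<notin> range (\<lambda>m::nat. 1 / q ^ m)"
    and "a * b \<notin> range (\<lambda>m::nat. 1 / q ^ m)"
  shows "summable (\<lambda>n. (-1) ^ (n + 1) * q ^ (((n + 1) * n) div 2) * (a ^ (n + 1) + b ^ (n + 1))) \<and>
         summable (\<lambda>n. qpoch (a * b / q) q (2 * n) * q ^ n / qpochs [q, a, b, a * b] q n) \<and>
         1 + (\<Sum>n. (-1) ^ (n + 1) * q ^ (((n + 1) * n) div 2) * (a ^ (n + 1) + b ^ (n + 1))) =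
         qpochs_inf [q, a, b] q *
         (\<Sum>n. qpoch (a * b / q) q (2 * n) * q ^ n / qpochs [q, a, b, a * b] q n)"
proof -
  note q = assms(1,2)
  let ?l = "\<lambda>n. (-1) ^ (n + 1) * q ^ (((n + 1) * n) div 2) * (a ^ (n + 1) + b ^ (n + 1))"
  let ?r = "\<lambda>n. qpoch (a * b / q) q (2 * n) * q ^ n / qpochs [q, a, b, a * b] q n"
  define G where "G y = qpoch_inf q q * wsum q y 0" for y
  \<comment> \<open>Removing the n = 0 term, which is 1, shifts the index and accounts for G y -
    1.\<close>
  have "(\<lambda>n. (-1) ^ (n + 1) * q ^ (((n + 1) * n) div 2) * y ^ (n + 1)) sums (G y - 1)" for y
    using partial_theta_sums[OF q, of y]
      sums_Suc_iff[of "\<lambda>n. (-1) ^ n * q ^ ((n * (n - 1)) div 2) * y ^ n" "G y - 1"]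
    by (simp add: G_def)
  from sums_add[OF this[of a] this[of b]]
  have l: "?l sums (G a - 1 + (G b - 1))"
    by (simp add: algebra_simps)
  \<comment> \<open>A convergent infinite product is zero only if some factor is zero.\<close>
  have inf_nz: "qpoch_inf y q \<noteq> 0" if "y \<notin> range (\<lambda>m::nat. 1 / q ^ m)" for y
    using has_prod_eq_0_iff[OF has_prod_qpoch_inf[OF q(2), of y]] that q
    by (auto simp: divide_simps)
  \<comment> \<open>Divide by (a,b;q)_inf to undo the normalization of \<open>wterm\<close>.\<close>
  have "?r n = wterm q a b (a * b) n / (qpoch_inf a q * qpoch_inf b q)" for n
  proof -
    have "q \<noteq> 0" using q by auto
    note nz = qpoch_nonzero[OF q assms(3), of n] qpoch_nonzero[OF q assms(4), of n]
      qpoch_nonzero[OF q assms(5), of n]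
    have inf: "qpoch_inf a q = qpoch a q n * qpoch_inf (a * q ^ n) q"
      "qpoch_inf b q = qpoch b q n * qpoch_inf (b * q ^ n) q"
      using qpoch_inf_split[OF q] by auto
    have "qpoch_inf (a * q ^ n) q \<noteq> 0" "qpoch_inf (b * q ^ n) q \<noteq> 0"
      using inf inf_nz assms(3,4) by auto
    with nz show ?thesis
      unfolding wterm_def inf cfac_mult_qpoch[OF \<open>q \<noteq> 0\<close>, symmetric]
      by (simp add: qpochs_def)
  qed
  then have r: "?r sums (wsum q a b / (qpoch_inf a q * qpoch_inf b q))"
    using sums_divide[OF summable_sums[OF summable_wterm[OF q]]] by (simp add: wsum_def)
  have "qpochs_inf [q, a, b] q * (wsum q a b / (qpoch_inf a q * qpoch_inf b q)) =
      qpoch_inf q q * wsum q a b"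
    using inf_nz assms(3,4) by (simp add: qpochs_inf_def)
  \<comment> \<open>Separation of variables with (q;q)_inf S(0,0) = 1; the left-hand side is 1 + (G
    a - 1) + (G b - 1).\<close>
  also have "\<dots> = G a + G b - 1"
    using qpoch_inf_wsum_0_0[OF q]
    by (subst wsum_separate[OF q]) (simp add: G_def ring_distribs)
  finally show ?thesis
    using l r by (simp add: sums_iff)
qed

end
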